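(* Let $T:\mathcal{B}_0\to\mathcal{B}_0$ be a nonzero bounded linear operator on the little Bloch space $\mathcal{B}_0$. Then $T$ is almost multiplicative if and only if $T=C_\varphi$ for some analytic self-map $\varphi$ of $\mathbb{D}$ with $\varphi\in\mathcal{B}_0$.
   Context: $\mathbb{D}$ is the open unit disc in $\mathbb{C}$. The Bloch space $\mathcal{B}$ is the Banach space of analytic functions $f$ on $\mathbb{D}$ with $\|f\|_{\mathcal{B}}=|f(0)|+\sup_{z\in\mathbb{D}}(1-|z|^2)|f'(z)|<\infty$. The little Bloch space $\mathcal{B}_0$ is the closed subspace of those $f\in\mathcal{B}$ with $(1-|z|^2)f'(z)\to0$ as $|z|\to1^-$. A bounded linear operator $T$ on a space $\mathcal{A}$ of analytic functions on $\mathbb{D}$ is almost multiplicative if $T(fg)=T(f)T(g)$ whenever $f,g,fg\in\mathcal{A}$ (pointwise product). For an analytic map $\varphi:\mathbb{D}\to\mathbb{D}$ (a self-map of $\mathbb{D}$), $C_\varphi f=f\circ\varphi$. *)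

theory Defs
  imports "HOL-Complex_Analysis.Complex_Analysis"
begin

abbreviation unit_disc :: "complex set" where
  "unit_disc \<equiv> ball 0 1"

(* HOL functions are total.  An analytic function on the unit disc is represented by its
   extension by 0, so that two elements of a function space are equal as HOL functions iff they
   agree on the disc.  The disc is open, so deriv f z for z in the disc does not depend on the
   values outside. *)
definition analytic_disc :: "(complex \<Rightarrow> complex) set" where
  "analytic_disc = {f. f analytic_on unit_disc \<and> (\<forall>z. z \<notin> unit_disc \<longrightarrow> f z = 0)}"

definition bloch_norm :: "(complex \<Rightarrow> complex) \<Rightarrow> real" where
  "bloch_norm f = cmod (f 0) + (SUP z\<in>unit_disc. (1 - (cmod z)\<^sup>2) * cmod (deriv f z))"

(* The supremum of an unbounded set of reals is unspecified, so finiteness of the norm is stated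
   as boundedness of the set. *)
definition bloch :: "(complex \<Rightarrow> complex) set" where
  "bloch = {f \<in> analytic_disc.
     bdd_above ((\<lambda>z. (1 - (cmod z)\<^sup>2) * cmod (deriv f z)) ` unit_disc)}"

definition little_bloch :: "(complex \<Rightarrow> complex) set" where
  "little_bloch = {f \<in> bloch.
     ((\<lambda>z. of_real (1 - (cmod z)\<^sup>2) * deriv f z) \<longlongrightarrow> 0) (filtercomap cmod (at_left 1))}"

(* Linearity is over the complex numbers; T is unconstrained outside A. *)
definition bounded_linear_op ::
  "(complex \<Rightarrow> complex) set \<Rightarrow> ((complex \<Rightarrow> complex) \<Rightarrow> real) \<Rightarrow>
   ((complex \<Rightarrow> complex) \<Rightarrow> (complex \<Rightarrow> complex)) \<Rightarrow> bool" where
  "bounded_linear_op A nrm T \<longleftrightarrow>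
     T \<in> A \<rightarrow> A \<and>
     (\<forall>f\<in>A. \<forall>g\<in>A. T (\<lambda>z. f z + g z) = (\<lambda>z. T f z + T g z)) \<and>
     (\<forall>c. \<forall>f\<in>A. T (\<lambda>z. c * f z) = (\<lambda>z. c * T f z)) \<and>
     (\<exists>K. \<forall>f\<in>A. nrm (T f) \<le> K * nrm f)"

definition almost_multiplicative ::
  "(complex \<Rightarrow> complex) set \<Rightarrow> ((complex \<Rightarrow> complex) \<Rightarrow> (complex \<Rightarrow> complex)) \<Rightarrow> bool" where
  "almost_multiplicative A T \<longleftrightarrow>
     (\<forall>f\<in>A. \<forall>g\<in>A. (\<lambda>z. f z * g z) \<in> A \<longrightarrow> T (\<lambda>z. f z * g z) = (\<lambda>z. T f z * T g z))"

definition composition_op ::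
  "(complex \<Rightarrow> complex) \<Rightarrow> (complex \<Rightarrow> complex) \<Rightarrow> (complex \<Rightarrow> complex)" where
  "composition_op \<phi> f = (\<lambda>z. if z \<in> unit_disc then (f \<circ> \<phi>) z else 0)"

end

theory Submission
  imports Defs
begin

text \<open>
  Write \<open>\<phi>\<close> for the image of the identity under \<open>T\<close>, fix \<open>w\<close> in the disc and put \<open>a = \<phi>(w)\<close>.
  Whenever \<open>f = c + (z - a) g\<close> with \<open>f\<close> and \<open>g\<close> in the little Bloch space, multiplicativity gives
  \<open>(T f)(w) = c\<close>.  If \<open>\<bar>a\<bar> > 1\<close>, this applies to \<open>1 = 0 + (z - a) / (z - a)\<close> and contradicts
  \<open>T 1 = 1\<close>.  If \<open>\<bar>a\<bar> = 1\<close>, it applies to \<open>-log (1 - \<rho> z / a)\<close> for \<open>\<rho> < 1\<close>: these functions have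
  Bloch norm at most 2, but their values at \<open>a\<close> tend to infinity as \<open>\<rho>\<close> tends to 1, which
  contradicts boundedness of \<open>T\<close>.  So \<open>\<bar>a\<bar> < 1\<close>, and then \<open>(f - f(a)) / (z - a)\<close> is in the little
  Bloch space for every \<open>f\<close> in it, because \<open>(1 - \<bar>z\<bar>\<^sup>2) f(z)\<close> tends to 0 at the boundary; hence
  \<open>(T f)(w) = f(a)\<close>.
\<close>

section \<open>Functions on the disc, extended by 0\<close>

definition disc_ext :: "(complex \<Rightarrow> complex) \<Rightarrow> complex \<Rightarrow> complex" where
  "disc_ext f = (\<lambda>z. if z \<in> unit_disc then f z else 0)"

lemma disc_ext_eq [simp]: "z \<in> unit_disc \<Longrightarrow> disc_ext f z = f z"
  by (simp add: disc_ext_def)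

lemma disc_ext_0 [simp]: "z \<notin> unit_disc \<Longrightarrow> disc_ext f z = 0"
  by (simp add: disc_ext_def)

lemma deriv_disc_ext:
  assumes "z \<in> unit_disc"
  shows "deriv (disc_ext f) z = deriv f z"
proof (rule deriv_cong_ev)
  show "\<forall>\<^sub>F x in nhds z. disc_ext f x = f x"
    using eventually_nhds_in_open[OF open_ball assms] by eventually_elim simp
qed simp

lemma disc_ext_analytic_disc:
  assumes "f holomorphic_on unit_disc"
  shows "disc_ext f \<in> analytic_disc"
proof -
  have "disc_ext f holomorphic_on unit_disc"
    using assms by (rule holomorphic_transform) simp
  then show ?thesis
    by (simp add: analytic_disc_def analytic_on_open)
qed

lemma analytic_discD:
  assumes "f \<in> analytic_disc"
  shows "f holomorphic_on unit_disc" "z \<notin> unit_disc \<Longrightarrow> f z = 0"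
  using assms by (auto simp: analytic_disc_def analytic_on_open)

lemma one_minus_norm_sq_pos: "cmod z < 1 \<Longrightarrow> 0 < 1 - (cmod z)\<^sup>2"
  by (simp add: power_less_one_iff abs_square_less_1)

section \<open>Boundary limits and membership in the little Bloch space\<close>

lemma eventually_filtercomap_cmod_at_left:
  "eventually P (filtercomap cmod (at_left 1)) \<longleftrightarrow> (\<exists>r<1. \<forall>z. r < cmod z \<and> cmod z < 1 \<longrightarrow> P z)"
  unfolding eventually_filtercomap
proof safe
  fix Q assume "eventually Q (at_left (1::real))" and Q: "\<forall>z. Q (cmod z) \<longrightarrow> P z"
  then obtain b where "b < 1" "\<And>y. b < y \<Longrightarrow> y < 1 \<Longrightarrow> Q y"
    \<comment> \<open>The library rule asks for some point to the left of 1; 0 is an arbitrary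
      choice.\<close>
    using eventually_at_left[of "0::real" 1 Q] by auto
  with Q show "\<exists>r<1. \<forall>z. r < cmod z \<and> cmod z < 1 \<longrightarrow> P z" by blast
next
  fix r :: real assume "r < 1" "\<forall>z. r < cmod z \<and> cmod z < 1 \<longrightarrow> P z"
  then show "\<exists>Q. eventually Q (at_left 1) \<and> (\<forall>z. Q (cmod z) \<longrightarrow> P z)"
    using eventually_at_left[of "0::real" 1 "\<lambda>y. r < y \<and> y < 1"]
    by (intro exI[of _ "\<lambda>y. r < y \<and> y < 1"]) auto
qed

text \<open>\<open>h\<close> is left arbitrary because the criterion serves both for derivatives
  and, in the growth estimate, for a function of the space itself.\<close>

lemma tendsto_0_boundary_iff:
  "((\<lambda>z. of_real (1 - (cmod z)\<^sup>2) * h z) \<longlongrightarrow> 0) (filtercomap cmod (at_left 1)) \<longleftrightarrow>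
    (\<forall>e>0. \<exists>r<1. \<forall>z. r < cmod z \<and> cmod z < 1 \<longrightarrow> (1 - (cmod z)\<^sup>2) * cmod (h z) < e)"
proof -
  have "norm (of_real (1 - (cmod z)\<^sup>2) * h z) = (1 - (cmod z)\<^sup>2) * cmod (h z)"
    if "cmod z < 1" for z
    using one_minus_norm_sq_pos[OF that] by (simp only: norm_mult norm_of_real abs_of_pos)
  then show ?thesis
    unfolding tendsto_iff eventually_filtercomap_cmod_at_left dist_0_norm dist_norm
    by (auto 0 3 simp del: of_real_diff)
qed

text \<open>The boundary condition already forces the boundedness that \<open>bloch\<close> demands:
  the weighted derivative is below 1 near the circle and continuous on the remaining compact
  disc.\<close>

lemma little_bloch_iff:
  "f \<in> little_bloch \<longleftrightarrow> f \<in> analytic_disc \<and>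
    (\<forall>e>0. \<exists>r<1. \<forall>z. r < cmod z \<and> cmod z < 1 \<longrightarrow> (1 - (cmod z)\<^sup>2) * cmod (deriv f z) < e)"
    (is "_ \<longleftrightarrow> _ \<and> ?lim")
proof -
  have "bdd_above ((\<lambda>z. (1 - (cmod z)\<^sup>2) * cmod (deriv f z)) ` unit_disc)"
    if f: "f \<in> analytic_disc" and ?lim
  proof -
    obtain r where r: "r < 1"
      "\<And>z. r < cmod z \<Longrightarrow> cmod z < 1 \<Longrightarrow> (1 - (cmod z)\<^sup>2) * cmod (deriv f z) < 1"
      using \<open>?lim\<close> zero_less_one by blast
    have "continuous_on unit_disc (deriv f)"
      using analytic_discD(1)[OF f] by (intro holomorphic_on_imp_continuous_on holomorphic_deriv) auto
    then have "continuous_on (cball 0 r) (\<lambda>z. (1 - (cmod z)\<^sup>2) * cmod (deriv f z))"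
      using r(1) by (intro continuous_intros) (auto elim!: continuous_on_subset)
    then have "bounded ((\<lambda>z. (1 - (cmod z)\<^sup>2) * cmod (deriv f z)) ` cball 0 r)"
      by (intro compact_imp_bounded compact_continuous_image) auto
    then have "bdd_above ((\<lambda>z. (1 - (cmod z)\<^sup>2) * cmod (deriv f z)) ` cball 0 r)"
      by (rule bounded_imp_bdd_above)
    then obtain C where C: "\<forall>z\<in>cball 0 r. (1 - (cmod z)\<^sup>2) * cmod (deriv f z) \<le> C"
      by (auto simp: bdd_above_def)
    have "(1 - (cmod z)\<^sup>2) * cmod (deriv f z) \<le> max C 1" if "cmod z < 1" for z
      using C[rule_format, of z] r(2)[of z] that by (cases "cmod z \<le> r") auto
    then show ?thesis by (intro bdd_aboveI[of _ "max C 1"]) auto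
  qed
  then show ?thesis
    unfolding little_bloch_def bloch_def tendsto_0_boundary_iff by auto
qed

lemma little_blochD:
  assumes "f \<in> little_bloch"
  shows "f holomorphic_on unit_disc" "z \<notin> unit_disc \<Longrightarrow> f z = 0"
  using assms analytic_discD by (auto simp: little_bloch_iff)

lemma little_bloch_lincomb:
  assumes f: "f \<in> little_bloch" and g: "g \<in> little_bloch"
  shows "(\<lambda>z. f z + c * g z) \<in> little_bloch"
proof -
  note hol = little_blochD(1)[OF f] little_blochD(1)[OF g]
  have "(\<lambda>z. f z + c * g z) \<in> analytic_disc"
    using little_blochD(2)[OF f] little_blochD(2)[OF g] hol
    by (auto simp: analytic_disc_def analytic_on_open intro!: holomorphic_intros)
  moreover have "deriv (\<lambda>z. f z + c * g z) z = deriv f z + c * deriv g z" if "z \<in> unit_disc" for z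
    by (rule DERIV_imp_deriv)
      (auto intro!: derivative_eq_intros holomorphic_derivI[OF _ open_ball that] hol)
  moreover have "((\<lambda>z. of_real (1 - (cmod z)\<^sup>2) * (deriv f z + c * deriv g z)) \<longlongrightarrow> 0)
      (filtercomap cmod (at_left 1))"
  proof -
    have "((\<lambda>z. of_real (1 - (cmod z)\<^sup>2) * deriv f z + c * (of_real (1 - (cmod z)\<^sup>2) * deriv g z))
        \<longlongrightarrow> 0 + c * 0) (filtercomap cmod (at_left 1))"
      using f g by (intro tendsto_intros) (auto simp: little_bloch_def)
    then show ?thesis by (simp add: algebra_simps)
  qed
  ultimately show ?thesis
    unfolding little_bloch_iff tendsto_0_boundary_iff by auto
qed

text \<open>The derivative is bounded on the closed unit disc, while the weight tends to 0 at the
  circle. All concrete test functions enter the space through this criterion.\<close>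

lemma holomorphic_beyond_disc_little_bloch:
  assumes "f holomorphic_on ball 0 R" "1 < R"
  shows "disc_ext f \<in> little_bloch"
proof -
  have "f holomorphic_on unit_disc"
    using assms by (auto elim!: holomorphic_on_subset)
  moreover have "\<exists>r<1. \<forall>z. r < cmod z \<and> cmod z < 1 \<longrightarrow>
      (1 - (cmod z)\<^sup>2) * cmod (deriv (disc_ext f) z) < e" if "e > 0" for e
  proof -
    have "continuous_on (ball 0 R) (deriv f)"
      using assms(1) by (intro holomorphic_on_imp_continuous_on holomorphic_deriv) auto
    then have "continuous_on (cball 0 1) (deriv f)"
      using assms(2) by (auto elim!: continuous_on_subset)
    then have "bounded (deriv f ` cball 0 1)"
      by (intro compact_imp_bounded compact_continuous_image) auto
    then obtain M where M: "M > 0" "\<And>z. cmod z \<le> 1 \<Longrightarrow> cmod (deriv f z) \<le> M"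
      by (auto simp: bounded_pos)
    have "(1 - (cmod z)\<^sup>2) * cmod (deriv (disc_ext f) z) < e"
      \<comment> \<open>The threshold comes from bounding the weight by
        \<open>2 * (1 - cmod z)\<close> and the derivative by \<open>M\<close>.\<close>
      if z: "1 - e / (2 * M) < cmod z" "cmod z < 1" for z
    proof -
      have "1 - (cmod z)\<^sup>2 = (1 - cmod z) * (1 + cmod z)"
        by (simp add: power2_eq_square algebra_simps)
      also have "\<dots> \<le> (1 - cmod z) * 2"
        using z by (intro mult_left_mono) auto
      finally have "1 - (cmod z)\<^sup>2 \<le> (1 - cmod z) * 2" .
      then have "(1 - (cmod z)\<^sup>2) * cmod (deriv f z) \<le> (1 - cmod z) * 2 * M"
        using M z by (intro mult_mono) auto
      also have "\<dots> < e"
        using z M(1) by (simp add: field_simps)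
      finally show ?thesis using z by (simp add: deriv_disc_ext)
    qed
    then show ?thesis
      using M(1) \<open>e > 0\<close> by (intro exI[of _ "1 - e / (2 * M)"]) auto
  qed
  ultimately show ?thesis
    by (simp add: little_bloch_iff disc_ext_analytic_disc)
qed

section \<open>Boundary growth and difference quotients\<close>

text \<open>Compare \<open>f z\<close> with its value at the radial projection \<open>y\<close> of
  \<open>z\<close> to a fixed circle. The weight decreases with the modulus, so on the segment
  between them the derivative is at most \<open>(e / 2) / (1 - (cmod z)\<^sup>2)\<close>, and the
  segment has length at most 1. The value \<open>f y\<close> is bounded, so the weight eventually
  makes its contribution less than \<open>e / 2\<close>.\<close>

lemma little_bloch_growth:
  assumes f: "f \<in> little_bloch"
  shows "((\<lambda>z. of_real (1 - (cmod z)\<^sup>2) * f z) \<longlongrightarrow> 0) (filtercomap cmod (at_left 1))"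
  unfolding tendsto_0_boundary_iff
proof (intro allI impI)
  fix e :: real assume "e > 0"
  note hol = little_blochD(1)[OF f]
  obtain r0 where r0: "r0 < 1"
    "\<And>z. r0 < cmod z \<Longrightarrow> cmod z < 1 \<Longrightarrow> (1 - (cmod z)\<^sup>2) * cmod (deriv f z) < e / 2"
    using f \<open>e > 0\<close> unfolding little_bloch_iff by (meson half_gt_zero)
  \<comment> \<open>This radius is positive, so that radial projection works, and exceeds
    \<open>r0\<close>, so that the whole segment lies where the derivative is controlled.\<close>
  define s where "s = (max r0 0 + 1) / 2"
  have s: "r0 < s" "0 < s" "s < 1" using r0(1) by (auto simp: s_def)
  have "continuous_on (cball 0 s) f"
    using s hol by (auto elim!: continuous_on_subset dest!: holomorphic_on_imp_continuous_on)
  then have "bounded (f ` cball 0 s)"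
    by (intro compact_imp_bounded compact_continuous_image) auto
  then obtain C where C: "C > 0" "\<And>z. cmod z \<le> s \<Longrightarrow> cmod (f z) \<le> C"
    by (auto simp: bounded_pos)
  have "(1 - (cmod z)\<^sup>2) * cmod (f z) < e"
    if z: "max s (1 - e / (4 * C)) < cmod z" "cmod z < 1" for z
  proof -
    have zs: "s < cmod z" and ze: "1 - e / (4 * C) < cmod z" using z by auto
    have pos: "0 < 1 - (cmod z)\<^sup>2" by (rule one_minus_norm_sq_pos) (use z in auto)
    define y where "y = of_real (s / cmod z) * z"
    have ny: "cmod y = s" using s zs by (auto simp: y_def norm_mult norm_divide)
    have seg: "s \<le> cmod x \<and> cmod x \<le> cmod z" if "x \<in> closed_segment y z" for x
    proof -
      from that obtain t where t: "0 \<le> t" "t \<le> 1" "x = (1 - t) *\<^sub>R y + t *\<^sub>R z"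
        by (auto simp: closed_segment_def)
      \<comment> \<open>The points of the segment lie on the ray through \<open>z\<close>, so their
        modulus is affine in \<open>t\<close>.\<close>
      define q where "q = (1 - t) * (s / cmod z) + t"
      have x: "x = of_real q * z"
        by (simp add: t(3) y_def q_def scaleR_conv_of_real algebra_simps)
      have "q \<ge> 0" using t s zs by (auto simp: q_def)
      then have "cmod x = q * cmod z" by (simp add: x norm_mult)
      also have "\<dots> = (1 - t) * s + t * cmod z"
        using s zs by (auto simp: q_def distrib_right)
      finally have nx: "cmod x = (1 - t) * s + t * cmod z" .
      have "(1 - t) * s + t * s \<le> cmod x"
        unfolding nx using t zs by (intro add_left_mono mult_left_mono) auto
      moreover have "cmod x \<le> (1 - t) * cmod z + t * cmod z"
        unfolding nx using t zs by (intro add_right_mono mult_left_mono) auto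
      ultimately show ?thesis by (simp add: algebra_simps)
    qed
    have "cmod (f z - f y) \<le> (e / 2) / (1 - (cmod z)\<^sup>2) * cmod (z - y)"
    proof (rule field_differentiable_bound[of "closed_segment y z" f "deriv f"])
      fix x assume x: "x \<in> closed_segment y z"
      then have x1: "s \<le> cmod x" "cmod x \<le> cmod z" using seg by auto
      then show "(f has_field_derivative deriv f x) (at x within closed_segment y z)"
        using z by (intro has_field_derivative_at_within[OF holomorphic_derivI[OF hol]]) auto
      have "(1 - (cmod z)\<^sup>2) * cmod (deriv f x) \<le> (1 - (cmod x)\<^sup>2) * cmod (deriv f x)"
        using x1 by (intro mult_right_mono diff_left_mono power_mono) auto
      also have "\<dots> < e / 2" using r0(2)[of x] x1 s z by auto
      finally show "cmod (deriv f x) \<le> (e / 2) / (1 - (cmod z)\<^sup>2)"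
        using pos by (simp add: field_simps)
    qed auto
    also have "\<dots> \<le> (e / 2) / (1 - (cmod z)\<^sup>2) * 1"
    proof (rule mult_left_mono)
      have "z - y = of_real (1 - s / cmod z) * z" by (simp add: y_def algebra_simps)
      moreover have "0 \<le> 1 - s / cmod z" using s zs by (simp add: divide_le_eq_1)
      ultimately have "cmod (z - y) = (1 - s / cmod z) * cmod z"
        by (simp only: norm_mult norm_of_real abs_of_nonneg)
      also have "\<dots> = cmod z - s" using s zs by (auto simp: field_simps)
      finally show "cmod (z - y) \<le> 1" using s z by simp
    qed (use pos \<open>e > 0\<close> in auto)
    finally have "(1 - (cmod z)\<^sup>2) * cmod (f z - f y) \<le> e / 2"
      using pos by (simp add: field_simps)
    moreover have "cmod (f z) \<le> cmod (f z - f y) + C"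
      using norm_triangle_sub[of "f z" "f y"] C(2)[of y] ny by simp
    then have "(1 - (cmod z)\<^sup>2) * cmod (f z) \<le> (1 - (cmod z)\<^sup>2) * (cmod (f z - f y) + C)"
      using pos by (intro mult_left_mono) auto
    moreover have "(1 - (cmod z)\<^sup>2) * C < e / 2"
    proof -
      have "1 - (cmod z)\<^sup>2 = (1 - cmod z) * (1 + cmod z)"
        by (simp add: power2_eq_square algebra_simps)
      also have "\<dots> \<le> (1 - cmod z) * 2"
        using z by (intro mult_left_mono) auto
      finally have "(1 - (cmod z)\<^sup>2) * C \<le> (1 - cmod z) * 2 * C"
        using C(1) by (intro mult_right_mono) auto
      also have "\<dots> < e / 2" using ze C(1) by (simp add: field_simps)
      finally show ?thesis .
    qed
    ultimately show ?thesis by (simp add: distrib_left)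
  qed
  then show "\<exists>r<1. \<forall>z. r < cmod z \<and> cmod z < 1 \<longrightarrow> (1 - (cmod z)\<^sup>2) * cmod (f z) < e"
    using s C(1) \<open>e > 0\<close> by (intro exI[of _ "max s (1 - e / (4 * C))"]) auto
qed

text \<open>Near the circle, \<open>z - a\<close> is bounded away from 0. The derivative of the
  quotient is then a combination of \<open>deriv f z\<close> and \<open>f z - f a\<close> with
  bounded factors. The weight sends the first to 0 by membership of \<open>f\<close>, the second by
  the growth estimate.\<close>

lemma little_bloch_difference_quotient:
  assumes f: "f \<in> little_bloch" and a: "a \<in> unit_disc"
  obtains g where "g \<in> little_bloch" "\<And>z. z \<in> unit_disc \<Longrightarrow> f z = f a + (z - a) * g z"
proof
  note hol = little_blochD(1)[OF f]
  \<comment> \<open>The value at \<open>a\<close> removes the singularity of the quotient.\<close>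
  define q where "q = (\<lambda>z. if z = a then deriv f a else (f z - f a) / (z - a))"
  have hq: "q holomorphic_on unit_disc"
    unfolding q_def by (rule pole_lemma_open[OF hol]) auto
  let ?F = "filtercomap cmod (at_left 1)"
  let ?p = "\<lambda>z. complex_of_real (1 - (cmod z)\<^sup>2)"
  \<comment> \<open>Half the distance from \<open>a\<close> to the unit circle.\<close>
  define d where "d = (1 - cmod a) / 2"
  have d: "d > 0" using a by (simp add: d_def)
  have far: "\<forall>\<^sub>F z in ?F. cmod z < 1 \<and> d \<le> cmod (z - a)"
    unfolding eventually_filtercomap_cmod_at_left
  proof (intro exI[of _ "1 - d"] conjI allI impI)
    fix z assume "1 - d < cmod z \<and> cmod z < 1"
    then show "d \<le> cmod (z - a)"
      using norm_triangle_ineq2[of z a] by (simp add: d_def field_simps)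
  qed (use d in auto)
  have inv: "Bfun (\<lambda>z. inverse (z - a)) ?F"
  proof (rule BfunI)
    show "\<forall>\<^sub>F z in ?F. norm (inverse (z - a)) \<le> inverse d"
      using far by eventually_elim (use d in \<open>auto simp: norm_inverse intro: le_imp_inverse_le\<close>)
  qed
  have p0: "(?p \<longlongrightarrow> 0) ?F"
  proof -
    have "((\<lambda>x::real. complex_of_real (1 - x\<^sup>2)) \<longlongrightarrow> of_real (1 - 1\<^sup>2)) (at_left 1)"
      by (intro tendsto_intros)
    then show ?thesis
      by (intro filterlim_compose[OF _ filterlim_filtercomap]) simp
  qed
  have lim: "((\<lambda>z. ?p z * deriv (disc_ext q) z) \<longlongrightarrow> 0) ?F"
  proof (rule Lim_transform_eventually)
    have lf': "((\<lambda>z. ?p z * deriv f z) \<longlongrightarrow> 0) ?F" using f by (simp add: little_bloch_def)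
    have lf: "((\<lambda>z. ?p z * f z - ?p z * f a) \<longlongrightarrow> 0 - 0 * f a) ?F"
      by (intro tendsto_intros little_bloch_growth[OF f] p0)
    \<comment> \<open>A null function times a bounded one is null.\<close>
    have Z: "((\<lambda>z. u z * inverse (z - a)) \<longlongrightarrow> 0) ?F" if "(u \<longlongrightarrow> 0) ?F" for u
      using bounded_bilinear.Zfun_prod_Bfun[OF bounded_bilinear_mult _ inv] that
      by (simp add: tendsto_Zfun_iff)
    have "((\<lambda>z. (?p z * deriv f z) * inverse (z - a)
        - (?p z * f z - ?p z * f a) * inverse (z - a) * inverse (z - a)) \<longlongrightarrow> 0 - 0) ?F"
      by (intro tendsto_diff Z lf') (use lf in simp)
    then show "((\<lambda>z. (?p z * deriv f z) * inverse (z - a)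
        - (?p z * f z - ?p z * f a) * inverse (z - a) * inverse (z - a)) \<longlongrightarrow> 0) ?F"
      by simp
    show "\<forall>\<^sub>F z in ?F. (?p z * deriv f z) * inverse (z - a)
        - (?p z * f z - ?p z * f a) * inverse (z - a) * inverse (z - a)
        = ?p z * deriv (disc_ext q) z"
      using far
    proof eventually_elim
      case (elim z)
      then have z: "z \<in> unit_disc" and za: "z \<noteq> a" using d by auto
      have "deriv q z = deriv (\<lambda>z. (f z - f a) / (z - a)) z"
      proof (rule deriv_cong_ev)
        have "\<forall>\<^sub>F x in nhds z. x \<in> - {a}"
          using za by (intro eventually_nhds_in_open) auto
        then show "\<forall>\<^sub>F x in nhds z. q x = (f x - f a) / (x - a)"
          by eventually_elim (simp add: q_def)
      qed simp
      also have "\<dots> = (deriv f z * (z - a) - (f z - f a)) / ((z - a) * (z - a))"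
        using za
        by (intro DERIV_imp_deriv)
          (auto intro!: derivative_eq_intros holomorphic_derivI[OF hol open_ball z])
      also have "\<dots> = deriv f z * inverse (z - a) - (f z - f a) * inverse (z - a) * inverse (z - a)"
        using za by (simp add: divide_simps)
      finally have "deriv (disc_ext q) z =
          deriv f z * inverse (z - a) - (f z - f a) * inverse (z - a) * inverse (z - a)"
        by (simp only: deriv_disc_ext[OF z])
      then show ?case by (simp only: ring_distribs mult.assoc)
    qed
  qed
  show "disc_ext q \<in> little_bloch"
    using disc_ext_analytic_disc[OF hq] lim
    unfolding little_bloch_iff tendsto_0_boundary_iff by auto
  show "f z = f a + (z - a) * disc_ext q z" if "z \<in> unit_disc" for z
    using that by (simp add: q_def)
qed

section \<open>Point evaluations and logarithmic test functions\<close>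

text \<open>On the disc of radius \<open>cmod w\<close> the weight is least at the rim, which bounds
  the derivative there; the mean value inequality does the rest. This turns a norm bound for
  \<open>T\<close> into a bound for \<open>T f w\<close>.\<close>

lemma bloch_point_evaluation:
  assumes f: "f \<in> bloch" and w: "w \<in> unit_disc"
  shows "cmod (f w) \<le> (1 + 1 / (1 - (cmod w)\<^sup>2)) * bloch_norm f"
proof -
  have hol: "f holomorphic_on unit_disc"
    using f analytic_discD(1) by (auto simp: bloch_def)
  define B where "B = (SUP z\<in>unit_disc. (1 - (cmod z)\<^sup>2) * cmod (deriv f z))"
  have B: "(1 - (cmod z)\<^sup>2) * cmod (deriv f z) \<le> B" if "z \<in> unit_disc" for z
    unfolding B_def using f that by (intro cSUP_upper) (auto simp: bloch_def)
  have B0: "0 \<le> B" using order_trans[OF norm_ge_zero[of "deriv f 0"]] B[of 0] by simp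
  have pos: "0 < 1 - (cmod w)\<^sup>2" using w by (intro one_minus_norm_sq_pos) auto
  have "cmod (f w - f 0) \<le> B / (1 - (cmod w)\<^sup>2) * cmod (w - 0)"
  proof (rule field_differentiable_bound[of "cball 0 (cmod w)" f "deriv f"])
    fix x :: complex assume x: "x \<in> cball 0 (cmod w)"
    then have xd: "x \<in> unit_disc" using w by auto
    show "(f has_field_derivative deriv f x) (at x within cball 0 (cmod w))"
      by (rule has_field_derivative_at_within[OF holomorphic_derivI[OF hol open_ball xd]])
    have "(1 - (cmod w)\<^sup>2) * cmod (deriv f x) \<le> (1 - (cmod x)\<^sup>2) * cmod (deriv f x)"
      using x by (intro mult_right_mono diff_left_mono power_mono) auto
    also note B[OF xd]
    finally show "cmod (deriv f x) \<le> B / (1 - (cmod w)\<^sup>2)"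
      using pos by (simp add: field_simps)
  qed auto
  also have "\<dots> \<le> B / (1 - (cmod w)\<^sup>2) * 1"
    using B0 pos w by (intro mult_left_mono) auto
  finally have "cmod (f w) \<le> cmod (f 0) + B / (1 - (cmod w)\<^sup>2)"
    using norm_triangle_sub[of "f w" "f 0"] by simp
  also have "\<dots> \<le> (1 + 1 / (1 - (cmod w)\<^sup>2)) * (cmod (f 0) + B)"
    using B0 pos by (simp add: distrib_left distrib_right add_increasing2)
  finally show ?thesis by (simp add: bloch_norm_def B_def)
qed

text \<open>The derivative \<open>b / (1 - b * z)\<close> has modulus at most
  \<open>1 / (1 - cmod z)\<close>, so the weighted one is at most \<open>1 + cmod z\<close>. What
  matters is that the bound is uniform in \<open>b\<close>.\<close>

lemma bloch_norm_log_le: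
  assumes "cmod b < 1"
  shows "bloch_norm (disc_ext (\<lambda>z. - Ln (1 - b * z))) \<le> 2"
proof -
  have "(1 - (cmod z)\<^sup>2) * cmod (deriv (disc_ext (\<lambda>z. - Ln (1 - b * z))) z) \<le> 2"
    if z: "z \<in> unit_disc" for z
  proof -
    have bz: "cmod (b * z) \<le> cmod z"
      using assms by (simp add: norm_mult mult_left_le_one_le)
    then have lt: "cmod (b * z) < 1" using z by simp
    then have re: "0 < Re (1 - b * z)"
      using complex_Re_le_cmod[of "b * z"] by simp
    then have np: "1 - b * z \<notin> \<real>\<^sub>\<le>\<^sub>0"
      using complex_nonpos_Reals_iff by force
    have "deriv (\<lambda>z. - Ln (1 - b * z)) z = b / (1 - b * z)"
      by (rule DERIV_imp_deriv) (use np in \<open>auto intro!: derivative_eq_intros simp: divide_inverse\<close>)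
    then have "cmod (deriv (\<lambda>z. - Ln (1 - b * z)) z) \<le> 1 / (1 - cmod z)"
      using assms z bz norm_triangle_ineq2[of 1 "b * z"]
      by (auto simp: norm_divide intro!: frac_le)
    then have "(1 - (cmod z)\<^sup>2) * cmod (deriv (\<lambda>z. - Ln (1 - b * z)) z)
        \<le> (1 - (cmod z)\<^sup>2) * (1 / (1 - cmod z))"
      using z one_minus_norm_sq_pos[of z] by (intro mult_left_mono) auto
    also have "\<dots> = 1 + cmod z"
      using z by (simp add: power2_eq_square field_simps)
    finally show ?thesis using z by (simp add: deriv_disc_ext)
  qed
  then have "(SUP z\<in>unit_disc. (1 - (cmod z)\<^sup>2) *
      cmod (deriv (disc_ext (\<lambda>z. - Ln (1 - b * z))) z)) \<le> 2"
    by (intro cSUP_least) auto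
  then show ?thesis by (simp add: bloch_norm_def)
qed

text \<open>Since \<open>b * z\<close> has modulus below 1, \<open>1 - b * z\<close> stays in the
  right half-plane, off the branch cut. For \<open>r < 1\<close> the domain reaches beyond the
  closed unit disc.\<close>

lemma holomorphic_log_one_minus:
  assumes "0 < r" "cmod b \<le> r"
  shows "(\<lambda>z. - Ln (1 - b * z)) holomorphic_on ball 0 (1 / r)"
proof -
  have "1 - b * z \<notin> \<real>\<^sub>\<le>\<^sub>0" if "z \<in> ball 0 (1 / r)" for z
  proof -
    have "cmod (b * z) \<le> r * cmod z"
      using assms by (simp add: norm_mult mult_right_mono)
    also have "\<dots> < 1" using that assms by (simp add: field_simps)
    finally have "0 < Re (1 - b * z)"
      using complex_Re_le_cmod[of "b * z"] by simp
    then show ?thesis using complex_nonpos_Reals_iff by force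
  qed
  then show ?thesis by (intro holomorphic_intros) auto
qed

section \<open>Almost multiplicative operators\<close>

lemma one_little_bloch: "disc_ext (\<lambda>_. 1) \<in> little_bloch"
  by (rule holomorphic_beyond_disc_little_bloch[of _ 2]) auto

lemma id_little_bloch: "disc_ext (\<lambda>z. z) \<in> little_bloch"
  by (rule holomorphic_beyond_disc_little_bloch[of _ 2]) auto

lemma bounded_linear_opD:
  assumes "bounded_linear_op A nrm T"
  shows "f \<in> A \<Longrightarrow> T f \<in> A"
    and "f \<in> A \<Longrightarrow> g \<in> A \<Longrightarrow> T (\<lambda>z. f z + g z) = (\<lambda>z. T f z + T g z)"
    and "f \<in> A \<Longrightarrow> T (\<lambda>z. c * f z) = (\<lambda>z. c * T f z)"
  using assms unfolding bounded_linear_op_def by blast+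

text \<open>Apply \<open>T\<close> to the product \<open>m * g = f - c\<close> with
  \<open>m = z - a\<close>: the factor \<open>T m\<close> vanishes at \<open>w\<close>, hence so
  does \<open>T f - c\<close>.\<close>

lemma almost_multiplicative_eval:
  assumes T: "bounded_linear_op little_bloch nrm T"
    and mult: "almost_multiplicative little_bloch T"
    and one: "T (disc_ext (\<lambda>_. 1)) w = 1"
    and f: "f \<in> little_bloch" and g: "g \<in> little_bloch"
    and eq: "\<And>z. z \<in> unit_disc \<Longrightarrow> f z = c + (z - T (disc_ext (\<lambda>z. z)) w) * g z"
  shows "T f w = c"
proof -
  let ?one = "disc_ext (\<lambda>_. 1)" and ?id = "disc_ext (\<lambda>z. z)"
  define a where "a = T ?id w"
  define m where "m = (\<lambda>z. ?id z + (- a) * ?one z)"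
  note lin = bounded_linear_opD[OF T]
  have scaled: "(\<lambda>z. b * ?one z) \<in> little_bloch" for b
    using holomorphic_beyond_disc_little_bloch[of "\<lambda>_. b" 2]
    by (simp add: disc_ext_def if_distrib cong: if_cong)
  have m: "m \<in> little_bloch"
    unfolding m_def by (rule little_bloch_lincomb[OF id_little_bloch one_little_bloch])
  have mg_eq: "(\<lambda>z. m z * g z) = (\<lambda>z. f z + (- c) * ?one z)"
  proof
    fix z show "m z * g z = f z + (- c) * ?one z"
      using eq[of z] little_blochD(2)[OF f, of z]
      by (cases "z \<in> unit_disc") (auto simp: m_def a_def)
  qed
  \<comment> \<open>Almost multiplicativity needs the product to lie in the space, which it does as
    a combination of \<open>f\<close> and a constant.\<close>
  have mg: "(\<lambda>z. m z * g z) \<in> little_bloch"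
    unfolding mg_eq by (rule little_bloch_lincomb[OF f one_little_bloch])
  have "T m = (\<lambda>z. T ?id z + (- a) * T ?one z)"
    unfolding m_def by (simp only: lin(2)[OF id_little_bloch scaled] lin(3)[OF one_little_bloch])
  then have "T m w = 0" using one by (simp add: a_def)
  moreover have "T (\<lambda>z. m z * g z) = (\<lambda>z. T m z * T g z)"
    using mult m g mg unfolding almost_multiplicative_def by blast
  ultimately have "T (\<lambda>z. f z + (- c) * ?one z) w = 0"
    by (simp only: mg_eq mult_zero_left)
  moreover have "T (\<lambda>z. f z + (- c) * ?one z) = (\<lambda>z. T f z + (- c) * T ?one z)"
    by (simp only: lin(2)[OF f scaled] lin(3)[OF one_little_bloch])
  ultimately show ?thesis using one by simp
qed

text \<open>The image of 1 is idempotent, so it takes only the values 0 and 1 and is constant on the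
  connected disc. It is not 0, since \<open>T f\<close> is a multiple of it for every
  \<open>f\<close> and some \<open>T f\<close> is nonzero.\<close>

lemma almost_multiplicative_one:
  assumes T: "bounded_linear_op little_bloch nrm T"
    and mult: "almost_multiplicative little_bloch T"
    and nz: "\<exists>f\<in>little_bloch. T f \<noteq> (\<lambda>z. 0)"
    and w: "w \<in> unit_disc"
  shows "T (disc_ext (\<lambda>_. 1)) w = 1"
proof -
  let ?one = "disc_ext (\<lambda>_. 1)"
  have mul: "T f = (\<lambda>z. T ?one z * T f z)" if f: "f \<in> little_bloch" for f
  proof -
    \<comment> \<open>The extended constant 1 is a unit here because \<open>f\<close> vanishes off
      the disc.\<close>
    have one_f: "(\<lambda>z. ?one z * f z) = f"
      using little_blochD(2)[OF f] by (auto simp: disc_ext_def)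
    then have "(\<lambda>z. ?one z * f z) \<in> little_bloch" using f by (simp only:)
    from mult[unfolded almost_multiplicative_def, rule_format, OF one_little_bloch f this]
    show ?thesis unfolding one_f .
  qed
  have T1: "T ?one \<in> little_bloch"
    using bounded_linear_opD(1)[OF T one_little_bloch] .
  have "T ?one z \<in> {0, 1}" for z
    using fun_cong[OF mul[OF one_little_bloch], of z] by (metis insertCI mult_cancel_right1)
  then have "T ?one ` unit_disc \<subseteq> {0, 1}" by blast
  then have fin: "finite (T ?one ` unit_disc)" by (rule finite_subset) simp
  have "T ?one constant_on unit_disc"
    by (rule continuous_finite_range_constant[OF _ _ fin])
      (auto intro: holomorphic_on_imp_continuous_on little_blochD(1)[OF T1])
  moreover obtain f v where f: "f \<in> little_bloch" and v: "T f v \<noteq> 0"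
    using nz by blast
  then have "v \<in> unit_disc"
    using little_blochD(2)[OF bounded_linear_opD(1)[OF T f]] by blast
  moreover have "T ?one v = 1"
    using fun_cong[OF mul[OF f], of v] v by simp
  ultimately show ?thesis using w by (metis constant_on_def)
qed

lemma almost_multiplicative_self_map:
  assumes T: "bounded_linear_op little_bloch bloch_norm T"
    and mult: "almost_multiplicative little_bloch T"
    and one: "T (disc_ext (\<lambda>_. 1)) w = 1"
    and w: "w \<in> unit_disc"
  shows "cmod (T (disc_ext (\<lambda>z. z)) w) < 1"
proof (rule ccontr)
  define a where "a = T (disc_ext (\<lambda>z. z)) w"
  note eval = almost_multiplicative_eval[OF T mult one, folded a_def]
  assume "\<not> cmod (T (disc_ext (\<lambda>z. z)) w) < 1"
  then consider "cmod a > 1" | "cmod a = 1" unfolding a_def by linarith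
  then show False
  proof cases
    case 1
    \<comment> \<open>The pole lies at distance \<open>cmod a > 1\<close> from the origin.\<close>
    then have "disc_ext (\<lambda>z. 1 / (z - a)) \<in> little_bloch"
      by (intro holomorphic_beyond_disc_little_bloch[of _ "cmod a"] holomorphic_intros) auto
    from eval[OF one_little_bloch this, of 0] 1 have "T (disc_ext (\<lambda>_. 1)) w = 0"
      by force
    with one show False by simp
  next
    case 2
    obtain K where K: "\<And>f. f \<in> little_bloch \<Longrightarrow> bloch_norm (T f) \<le> K * bloch_norm f"
      using T unfolding bounded_linear_op_def by blast
    define D where "D = 1 + 1 / (1 - (cmod w)\<^sup>2)"
    have D: "D > 0" using w one_minus_norm_sq_pos[of w] by (auto simp: D_def intro!: add_pos_pos)
    \<comment> \<open>\<open>D * (\<bar>K\<bar> * 2)\<close> is the bound that boundedness of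
      \<open>T\<close> and point evaluation impose on \<open>T (disc_ext l) w\<close>;
      \<open>X\<close> exceeds it.\<close>
    define X where "X = D * (\<bar>K\<bar> * 2) + 1"
    have X: "X > 0" using D by (auto simp: X_def intro!: add_nonneg_pos)
    \<comment> \<open>Chosen so that \<open>1 - r = exp (- X)\<close>, which makes
      \<open>l a\<close> equal to \<open>X\<close>.\<close>
    define r where "r = 1 - exp (- X)"
    have r: "0 < r" "r < 1" using X by (auto simp: r_def)
    \<comment> \<open>As \<open>cmod a = 1\<close>, this is \<open>r / a\<close>.\<close>
    define b where "b = of_real r * cnj a"
    have nb: "cmod b = r" using r 2 by (simp add: b_def norm_mult)
    have ba: "b * a = of_real r"
      using 2 by (simp add: b_def complex_norm_square[symmetric] mult.assoc mult.commute[of "cnj a"])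
    define l where "l = (\<lambda>z. - Ln (1 - b * z))"
    have la: "l a = of_real X"
    proof -
      have "1 - b * a = exp (- of_real X)"
        by (simp add: ba r_def exp_of_real flip: of_real_minus)
      then show ?thesis by (simp add: l_def flip: of_real_minus exp_of_real)
    qed
    have hl: "l holomorphic_on ball 0 (1 / r)"
      unfolding l_def by (rule holomorphic_log_one_minus) (use r nb in auto)
    \<comment> \<open>Since \<open>1 / r > 1\<close>, the point \<open>a\<close> is interior to the
      domain of \<open>l\<close>, so the quotient extends holomorphically across it.\<close>
    define q where "q = (\<lambda>z. if z = a then deriv l a else (l z - l a) / (z - a))"
    have hq: "q holomorphic_on ball 0 (1 / r)"
      unfolding q_def by (rule pole_lemma_open[OF hl]) auto
    have R: "1 < 1 / r" using r by simp
    note L = holomorphic_beyond_disc_little_bloch[OF hl R]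
    have "T (disc_ext l) w = l a"
      by (rule eval[OF L holomorphic_beyond_disc_little_bloch[OF hq R]]) (simp add: q_def)
    then have "X = cmod (T (disc_ext l) w)" using X by (simp add: la)
    also have "\<dots> \<le> D * bloch_norm (T (disc_ext l))"
      unfolding D_def
      by (rule bloch_point_evaluation[OF _ w])
        (use bounded_linear_opD(1)[OF T L] in \<open>simp add: little_bloch_def\<close>)
    also have "bloch_norm (T (disc_ext l)) \<le> \<bar>K\<bar> * 2"
    proof -
      have le2: "bloch_norm (disc_ext l) \<le> 2"
        unfolding l_def by (rule bloch_norm_log_le) (use nb r in simp)
      have "disc_ext l \<in> bloch" using L by (simp add: little_bloch_def)
      \<comment> \<open>The norm is nonnegative because, times the positive factor \<open>D\<close>,
        it bounds a modulus.\<close>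
      from order_trans[OF norm_ge_zero bloch_point_evaluation[OF this w]]
      have "0 \<le> bloch_norm (disc_ext l)"
        using D by (simp add: D_def zero_le_mult_iff)
      then have "K * bloch_norm (disc_ext l) \<le> \<bar>K\<bar> * 2"
        using le2 by (intro mult_mono) auto
      then show ?thesis using K[OF L] by linarith
    qed
    finally have "X \<le> D * (\<bar>K\<bar> * 2)" using D by (simp add: mult_left_mono)
    then show False by (simp add: X_def)
  qed
qed

theorem theorem4p1:
  fixes T :: "(complex \<Rightarrow> complex) \<Rightarrow> (complex \<Rightarrow> complex)"
  assumes "bounded_linear_op little_bloch bloch_norm T"
    and "\<exists>f\<in>little_bloch. T f \<noteq> (\<lambda>z. 0)"
  shows "almost_multiplicative little_bloch T \<longleftrightarrow>
    (\<exists>\<phi>. \<phi> analytic_on unit_disc \<and> \<phi> ` unit_disc \<subseteq> unit_disc \<and> \<phi> \<in> little_bloch \<and>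
         (\<forall>f\<in>little_bloch. T f = composition_op \<phi> f))"
proof
  assume mult: "almost_multiplicative little_bloch T"
  define \<phi> where "\<phi> = T (disc_ext (\<lambda>z. z))"
  note one = almost_multiplicative_one[OF assms(1) mult assms(2)]
  have \<phi>: "\<phi> \<in> little_bloch"
    unfolding \<phi>_def by (rule bounded_linear_opD(1)[OF assms(1) id_little_bloch])
  have self: "\<phi> w \<in> unit_disc" if "w \<in> unit_disc" for w
    using almost_multiplicative_self_map[OF assms(1) mult one[OF that] that] by (simp add: \<phi>_def)
  have "T f = composition_op \<phi> f" if f: "f \<in> little_bloch" for f
  proof
    fix w
    show "T f w = composition_op \<phi> f w"
    proof (cases "w \<in> unit_disc")
      case True
      obtain g where "g \<in> little_bloch"
        "\<And>z. z \<in> unit_disc \<Longrightarrow> f z = f (\<phi> w) + (z - \<phi> w) * g z"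
        using little_bloch_difference_quotient[OF f self[OF True]] by blast
      then have "T f w = f (\<phi> w)"
        unfolding \<phi>_def by (intro almost_multiplicative_eval[OF assms(1) mult one[OF True] f])
      then show ?thesis using True by (simp add: composition_op_def)
    next
      case False
      then show ?thesis
        using little_blochD(2)[OF bounded_linear_opD(1)[OF assms(1) f]]
        by (simp add: composition_op_def)
    qed
  qed
  moreover have "\<phi> analytic_on unit_disc"
    using little_blochD(1)[OF \<phi>] by (simp add: analytic_on_open)
  ultimately show "\<exists>\<phi>. \<phi> analytic_on unit_disc \<and> \<phi> ` unit_disc \<subseteq> unit_disc \<and> \<phi> \<in> little_bloch \<and>
      (\<forall>f\<in>little_bloch. T f = composition_op \<phi> f)"
    using \<phi> self by blast
next
  assume "\<exists>\<phi>. \<phi> analytic_on unit_disc \<and> \<phi> ` unit_disc \<subseteq> unit_disc \<and> \<phi> \<in> little_bloch \<and>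
      (\<forall>f\<in>little_bloch. T f = composition_op \<phi> f)"
  \<comment> \<open>Composition respects products pointwise on the disc, and off the disc both sides
    are 0.\<close>
  then show "almost_multiplicative little_bloch T"
    by (auto simp: almost_multiplicative_def composition_op_def fun_eq_iff)
qed

end
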